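(* Let $\mathbb{K}\in\{\mathbb{R},\mathbb{C}\}$ and let $\mathbf{A},\mathbf{C}\in\mathbb{IK}^{m\times m}$ and $\mathbf{B},\mathbf{D}\in\mathbb{IK}^{n\times n}$ be interval matrices. Suppose that the inequality (understood entrywise) $$|A^{c}XB^{c}+C^{c}XD^{c}|\leq \operatorname{mag}(\mathbf{A})\,|X|\,B^{\Delta}+A^{\Delta}\,|XB^{c}|+\operatorname{mag}(\mathbf{C})\,|X|\,D^{\Delta}+C^{\Delta}\,|XD^{c}|$$ has, among $X\in\mathbb{K}^{m\times n}$, only the trivial solution $X=0$. Then for every interval matrix $\mathbf{F}\in\mathbb{IK}^{m\times n}$ the united solution set $$\Xi=\{X\in\mathbb{K}^{m\times n}:\ \exists A\in\mathbf{A},\ \exists B\in\mathbf{B},\ \exists C\in\mathbf{C},\ \exists D\in\mathbf{D},\ \exists F\in\mathbf{F},\ AXB+CXD=F\}$$ is bounded.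
   Context: An interval over $\mathbb{K}$ is a set $\langle x^{c},x^{\Delta}\rangle=\{x\in\mathbb{K}:|x-x^{c}|\le x^{\Delta}\}$ with midpoint $x^{c}\in\mathbb{K}$ and radius $0\le x^{\Delta}\in\mathbb{R}$ (a closed bounded real interval if $\mathbb{K}=\mathbb{R}$, a closed disc if $\mathbb{K}=\mathbb{C}$). $\mathbb{IK}^{p\times q}$ is the set of $p\times q$ matrices $\mathbf{M}=(\mathbf{M}_{ij})$ of such intervals; $M\in\mathbf{M}$ means $M\in\mathbb{K}^{p\times q}$ and $M_{ij}\in\mathbf{M}_{ij}$ for all $i,j$. $M^{c}$ and $M^{\Delta}$ denote the matrices of midpoints and of radii of $\mathbf{M}$. The magnitude is $\operatorname{mag}(\mathbf{M})=|M^{c}|+M^{\Delta}$. For a point matrix $X$, $|X|$ is the matrix of entrywise absolute values (moduli), and inequalities between matrices are entrywise. *)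

theory Defs
  imports "HOL-Analysis.Analysis"
begin

text \<open>
  Intervals in midpoint-radius form: closed bounded intervals over \<open>real\<close>, closed discs over
  \<open>complex\<close>. An interval is represented by the pair of its midpoint and radius rather than by
  its set of points; over both fields the points determine the pair, see \<open>ipoints_inject\<close>.
\<close>

typedef (overloaded) 'a ivl = "{(c :: 'a :: real_normed_vector, r :: real). 0 \<le> r}"
  by auto

definition imid :: "'a :: real_normed_vector ivl \<Rightarrow> 'a"
  where "imid I = fst (Rep_ivl I)"

definition irad :: "'a :: real_normed_vector ivl \<Rightarrow> real"
  where "irad I = snd (Rep_ivl I)"

definition ipoints :: "'a :: real_normed_vector ivl \<Rightarrow> 'a set"
  where "ipoints I = {x. norm (x - imid I) \<le> irad I}"

lemma irad_nonneg: "0 \<le> irad I"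
  using Rep_ivl[of I] by (auto simp: irad_def)

lemma ex_ivl: "0 \<le> r \<Longrightarrow> \<exists>I. imid I = c \<and> irad I = r"
  by (rule exI[of _ "Abs_ivl (c, r)"]) (simp add: imid_def irad_def Abs_ivl_inverse)

lemma ipoints_eq_cball: "ipoints I = cball (imid I) (irad I)"
  by (auto simp: ipoints_def dist_norm norm_minus_commute)

lemma ivl_eqI: "imid I = imid J \<Longrightarrow> irad I = irad J \<Longrightarrow> I = J"
  by (simp add: imid_def irad_def prod_eq_iff flip: Rep_ivl_inject)

lemma ipoints_inject:
  fixes I J :: "'a :: euclidean_space ivl"
  shows "ipoints I = ipoints J \<longleftrightarrow> I = J"
  using irad_nonneg[of I] irad_nonneg[of J]
  by (auto simp: ipoints_eq_cball cball_eq_cball_iff intro: ivl_eqI)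

text \<open>
  In \<open>'a ^ 'q ^ 'p\<close> the index type \<open>'p\<close> counts rows and \<open>'q\<close> columns. The library's order on
  \<open>real ^ 'q ^ 'p\<close> is the entrywise one (\<open>less_eq_vec_def\<close>).
\<close>

definition mid_mat :: "'a :: real_normed_vector ivl ^ 'q ^ 'p \<Rightarrow> 'a ^ 'q ^ 'p"
  where "mid_mat M = (\<chi> i j. imid (M $ i $ j))"

definition rad_mat :: "'a :: real_normed_vector ivl ^ 'q ^ 'p \<Rightarrow> real ^ 'q ^ 'p"
  where "rad_mat M = (\<chi> i j. irad (M $ i $ j))"

definition abs_mat :: "'a :: real_normed_vector ^ 'q ^ 'p \<Rightarrow> real ^ 'q ^ 'p"
  where "abs_mat X = (\<chi> i j. norm (X $ i $ j))"

definition mag :: "'a :: real_normed_vector ivl ^ 'q ^ 'p \<Rightarrow> real ^ 'q ^ 'p"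
  where "mag M = abs_mat (mid_mat M) + rad_mat M"

definition mat_in :: "'a :: real_normed_vector ^ 'q ^ 'p \<Rightarrow> 'a ivl ^ 'q ^ 'p \<Rightarrow> bool"
    (infix "\<in>\<in>" 50)
  where "X \<in>\<in> M \<longleftrightarrow> (\<forall>i j. X $ i $ j \<in> ipoints (M $ i $ j))"

definition united_solution_set ::
    "'a :: real_normed_field ivl ^ 'm ^ 'm \<Rightarrow> 'a ivl ^ 'n ^ 'n \<Rightarrow>
     'a ivl ^ 'm ^ 'm \<Rightarrow> 'a ivl ^ 'n ^ 'n \<Rightarrow> 'a ivl ^ 'n ^ 'm \<Rightarrow> ('a ^ 'n ^ 'm) set"
  where "united_solution_set \<A> \<B> \<C> \<D> \<F> =
    {X. \<exists>A B C D F. A \<in>\<in> \<A> \<and> B \<in>\<in> \<B> \<and> C \<in>\<in> \<C> \<and> D \<in>\<in> \<D> \<and> F \<in>\<in> \<F> \<and>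
        A ** X ** B + C ** X ** D = F}"

end

theory Submission imports Defs begin

text \<open>
  The inequality in the hypothesis is the homogeneous form of an inequality that every solution
  of an equation \<open>A ** X ** B + C ** X ** D = F\<close> satisfies: with
  midpoints \<open>Ac\<close> and \<open>Bc\<close>, writing
  \<open>A ** X ** B = Ac ** X ** Bc + A ** X ** (B - Bc) + (A - Ac) ** X ** Bc\<close> and likewise for
  \<open>C ** X ** D\<close>, the triangle inequality bounds the midpoint operator at \<open>X\<close> by the right-hand
  side of the hypothesis plus \<open>mag \<F>\<close> (\<open>united_solution_residual_le\<close>).

  So the difference of the two sides, called \<open>residual\<close> below, is at most the constant matrix
  \<open>mag \<F>\<close> on the united solution set. It is continuous and positively homogeneous, and the
  hypothesis says that at each \<open>X \<noteq> 0\<close> some entry of it is positive. By compactness of the unit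
  sphere the sum of the positive parts of its entries is at least some \<open>\<delta> > 0\<close> there, hence at
  least \<open>\<delta> * norm X\<close> everywhere, and therefore \<open>norm X\<close> is bounded on the united solution set
  (\<open>bounded_homogeneous_le\<close>). The argument is the same over both fields.
\<close>

section \<open>Entrywise inequalities for matrices\<close>

lemma mat_le_iff:
  fixes M N :: "real ^ 'q ^ 'p"
  shows "M \<le> N \<longleftrightarrow> (\<forall>i j. M $ i $ j \<le> N $ i $ j)"
  by (simp add: less_eq_vec_def)

lemma abs_mat_nonneg: "0 \<le> abs_mat X"
  by (simp add: mat_le_iff abs_mat_def)

lemma mat_mult_mono:
  fixes M M' :: "real ^ 'q ^ 'p" and N N' :: "real ^ 'r ^ 'q"
  assumes "M \<le> M'" "N \<le> N'" "0 \<le> M" "0 \<le> N"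
  shows "M ** N \<le> M' ** N'"
proof -
  have "M $ i $ k * N $ k $ j \<le> M' $ i $ k * N' $ k $ j" for i j k
  proof (rule mult_mono)
    show "0 \<le> M' $ i $ k"
      using assms(1,3) unfolding mat_le_iff by (metis order_trans zero_index)
  qed (use assms in \<open>auto simp: mat_le_iff\<close>)
  then show ?thesis
    by (simp add: mat_le_iff matrix_matrix_mult_def sum_mono)
qed

lemma abs_mat_triangle: "abs_mat (X + Y) \<le> abs_mat X + abs_mat Y"
  by (simp add: mat_le_iff abs_mat_def norm_triangle_ineq)

lemma abs_mat_diff_triangle: "abs_mat (X - Y) \<le> abs_mat X + abs_mat Y"
  by (simp add: mat_le_iff abs_mat_def norm_triangle_ineq4)

lemma abs_mat_mult_le:
  fixes X :: "'a :: real_normed_field ^ 'q ^ 'p" and Y :: "'a ^ 'r ^ 'q"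
  shows "abs_mat (X ** Y) \<le> abs_mat X ** abs_mat Y"
  by (auto simp: mat_le_iff abs_mat_def matrix_matrix_mult_def norm_mult
           intro!: order_trans[OF norm_sum])

lemma abs_mat_mult_mono:
  fixes X :: "'a :: real_normed_field ^ 'q ^ 'p" and Y :: "'a ^ 'r ^ 'q"
  assumes "abs_mat X \<le> M" "abs_mat Y \<le> N"
  shows "abs_mat (X ** Y) \<le> M ** N"
  using abs_mat_mult_le mat_mult_mono[OF assms abs_mat_nonneg abs_mat_nonneg]
  by (rule order_trans)

lemma mat_in_abs_mid_le: "X \<in>\<in> M \<Longrightarrow> abs_mat (X - mid_mat M) \<le> rad_mat M"
  by (simp add: mat_le_iff mat_in_def abs_mat_def mid_mat_def rad_mat_def ipoints_def)

lemma mat_in_abs_le_mag: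
  assumes "X \<in>\<in> M"
  shows "abs_mat X \<le> mag M"
proof -
  have "abs_mat X \<le> abs_mat (mid_mat M) + abs_mat (X - mid_mat M)"
    using abs_mat_triangle[of "mid_mat M" "X - mid_mat M"] by simp
  also have "\<dots> \<le> mag M"
    unfolding mag_def using mat_in_abs_mid_le[OF assms] by (rule add_left_mono)
  finally show ?thesis .
qed

section \<open>The residual of the midpoint operator\<close>

text \<open>
  A bound on how far \<open>A ** X ** B\<close> can move from its midpoint value while \<open>A\<close> and \<open>B\<close> range over
  their interval matrices.
\<close>

definition width_bound ::
    "'a :: real_normed_field ivl ^ 'm ^ 'm \<Rightarrow> 'a ivl ^ 'n ^ 'n \<Rightarrow> 'a ^ 'n ^ 'm \<Rightarrow> real ^ 'n ^ 'm"
  where "width_bound \<A> \<B> X =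
    mag \<A> ** abs_mat X ** rad_mat \<B> + rad_mat \<A> ** abs_mat (X ** mid_mat \<B>)"

definition residual ::
    "'a :: real_normed_field ivl ^ 'm ^ 'm \<Rightarrow> 'a ivl ^ 'n ^ 'n \<Rightarrow>
     'a ivl ^ 'm ^ 'm \<Rightarrow> 'a ivl ^ 'n ^ 'n \<Rightarrow> 'a ^ 'n ^ 'm \<Rightarrow> real ^ 'n ^ 'm"
  where "residual \<A> \<B> \<C> \<D> X =
    abs_mat (mid_mat \<A> ** X ** mid_mat \<B> + mid_mat \<C> ** X ** mid_mat \<D>)
      - (width_bound \<A> \<B> X + width_bound \<C> \<D> X)"

lemma matrix_mult_diff_left:
  fixes X Y :: "'a :: ring_1 ^ 'q ^ 'p" and Z :: "'a ^ 'r ^ 'q"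
  shows "(X - Y) ** Z = X ** Z - Y ** Z"
  by (simp add: vec_eq_iff matrix_matrix_mult_def left_diff_distrib sum_subtractf)

lemma matrix_mult_diff_right:
  fixes X :: "'a :: ring_1 ^ 'q ^ 'p" and Y Z :: "'a ^ 'r ^ 'q"
  shows "X ** (Y - Z) = X ** Y - X ** Z"
  by (simp add: vec_eq_iff matrix_matrix_mult_def right_diff_distrib sum_subtractf)

text \<open>
  Splitting off the factor \<open>B - mid_mat \<B>\<close> first leaves \<open>mid_mat \<B>\<close> next to \<open>X\<close> in the other
  term. That is why \<open>mag \<A>\<close> occurs in the first summand of \<^const>\<open>width_bound\<close>, and why the second
  one can keep the smaller \<open>abs_mat (X ** mid_mat \<B>)\<close> instead of a product of absolute values.
\<close>

lemma abs_mat_mult_mid_le: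
  fixes \<A> :: "'a :: real_normed_field ivl ^ 'm ^ 'm" and \<B> :: "'a ivl ^ 'n ^ 'n"
  assumes A: "A \<in>\<in> \<A>" and B: "B \<in>\<in> \<B>"
  shows "abs_mat (A ** X ** B - mid_mat \<A> ** X ** mid_mat \<B>) \<le> width_bound \<A> \<B> X"
proof -
  have "A ** X ** B - mid_mat \<A> ** X ** mid_mat \<B>
      = A ** X ** (B - mid_mat \<B>) + (A - mid_mat \<A>) ** (X ** mid_mat \<B>)"
    by (simp add: matrix_mult_diff_left matrix_mult_diff_right matrix_mul_assoc)
  also have "abs_mat \<dots> \<le> abs_mat (A ** X ** (B - mid_mat \<B>))
      + abs_mat ((A - mid_mat \<A>) ** (X ** mid_mat \<B>))"
    by (rule abs_mat_triangle)
  also have "\<dots> \<le> width_bound \<A> \<B> X"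
    unfolding width_bound_def
    by (intro add_mono abs_mat_mult_mono mat_in_abs_le_mag[OF A] mat_in_abs_mid_le[OF A]
        mat_in_abs_mid_le[OF B] order_refl)
  finally show ?thesis .
qed

lemma united_solution_residual_le:
  fixes \<A> :: "'a :: real_normed_field ivl ^ 'm ^ 'm" and \<B> :: "'a ivl ^ 'n ^ 'n"
  assumes "X \<in> united_solution_set \<A> \<B> \<C> \<D> \<F>"
  shows "residual \<A> \<B> \<C> \<D> X \<le> mag \<F>"
proof -
  obtain A B C D where A: "A \<in>\<in> \<A>" and B: "B \<in>\<in> \<B>" and C: "C \<in>\<in> \<C>" and D: "D \<in>\<in> \<D>"
    and F: "A ** X ** B + C ** X ** D \<in>\<in> \<F>"
    using assms by (auto simp: united_solution_set_def)
  let ?P = "A ** X ** B - mid_mat \<A> ** X ** mid_mat \<B>"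
  let ?Q = "C ** X ** D - mid_mat \<C> ** X ** mid_mat \<D>"
  have "abs_mat (mid_mat \<A> ** X ** mid_mat \<B> + mid_mat \<C> ** X ** mid_mat \<D>)
      = abs_mat ((A ** X ** B + C ** X ** D) - (?P + ?Q))"
    by (simp add: algebra_simps)
  also have "\<dots> \<le> abs_mat (A ** X ** B + C ** X ** D) + abs_mat (?P + ?Q)"
    by (rule abs_mat_diff_triangle)
  also have "\<dots> \<le> mag \<F> + (width_bound \<A> \<B> X + width_bound \<C> \<D> X)"
    by (intro add_mono mat_in_abs_le_mag[OF F] order_trans[OF abs_mat_triangle]
        abs_mat_mult_mid_le[OF A B] abs_mat_mult_mid_le[OF C D])
  finally show ?thesis
    by (simp add: residual_def diff_le_eq)
qed

lemma abs_mat_scaleR: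
  "abs_mat (t *\<^sub>R X) = \<bar>t\<bar> *\<^sub>R abs_mat X"
  by (simp add: vec_eq_iff abs_mat_def)

lemma matrix_mult_scaleR_left:
  fixes X :: "'a :: real_normed_field ^ 'q ^ 'p" and Y :: "'a ^ 'r ^ 'q"
  shows "(t *\<^sub>R X) ** Y = t *\<^sub>R (X ** Y)"
  by (simp add: vec_eq_iff matrix_matrix_mult_def scaleR_sum_right)

lemma matrix_mult_scaleR_right:
  fixes X :: "'a :: real_normed_field ^ 'q ^ 'p" and Y :: "'a ^ 'r ^ 'q"
  shows "X ** (t *\<^sub>R Y) = t *\<^sub>R (X ** Y)"
  by (simp add: vec_eq_iff matrix_matrix_mult_def scaleR_sum_right)

lemma residual_scaleR:
  assumes "0 \<le> t"
  shows "residual \<A> \<B> \<C> \<D> (t *\<^sub>R X) = t *\<^sub>R residual \<A> \<B> \<C> \<D> X"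
  using assms
  by (simp add: residual_def width_bound_def abs_mat_scaleR matrix_mult_scaleR_left
      matrix_mult_scaleR_right scaleR_right_diff_distrib flip: scaleR_right_distrib)

lemma continuous_on_abs_mat [continuous_intros]:
  "continuous_on S f \<Longrightarrow> continuous_on S (\<lambda>x. abs_mat (f x))"
  unfolding abs_mat_def by (intro continuous_intros)

lemma continuous_on_matrix_mult [continuous_intros]:
  fixes f :: "'b :: topological_space \<Rightarrow> 'a :: real_normed_field ^ 'q ^ 'p" and g :: "'b \<Rightarrow> 'a ^ 'r ^ 'q"
  assumes "continuous_on S f" "continuous_on S g"
  shows "continuous_on S (\<lambda>x. f x ** g x)"
  unfolding matrix_matrix_mult_def by (intro continuous_intros assms)

lemma continuous_on_residual: "continuous_on S (residual \<A> \<B> \<C> \<D>)"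
  unfolding residual_def width_bound_def by (intro continuous_intros)

section \<open>Boundedness from homogeneity\<close>

text \<open>
  A continuous positively homogeneous function that is positive away from \<open>0\<close> attains a positive
  minimum \<open>\<delta>\<close> on the compact unit sphere, and homogeneity turns this into the growth bound
  \<open>\<delta> * norm x \<le> f x\<close>.
\<close>

lemma bounded_homogeneous_sublevel:
  fixes f :: "'b :: euclidean_space \<Rightarrow> real"
  assumes cont: "continuous_on (sphere 0 1) f"
    and hom: "\<And>t x. 0 \<le> t \<Longrightarrow> f (t *\<^sub>R x) = t * f x"
    and pos: "\<And>x. x \<noteq> 0 \<Longrightarrow> 0 < f x"
  shows "bounded {x. f x \<le> c}"
proof -
  have "sphere (0 :: 'b) 1 \<noteq> {}"
    by simp
  then obtain u where u: "u \<in> sphere 0 1" and u_min: "\<And>x. x \<in> sphere 0 1 \<Longrightarrow> f u \<le> f x"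
    using continuous_attains_inf[OF compact_sphere _ cont] by blast
  have "0 < f u"
    using u by (intro pos) auto
  have "norm x \<le> c / f u" if "f x \<le> c" for x
  proof -
    have "f u * norm x \<le> f x"
    proof (cases "x = 0")
      case True
      then show ?thesis
        using hom[of 0 0] by simp
    next
      case False
      then have "f u \<le> f (x /\<^sub>R norm x)"
        by (intro u_min) simp
      then show ?thesis
        using False hom[of "inverse (norm x)" x] mult_left_mono[of "f u" _ "norm x"]
        by (fastforce simp: field_simps)
    qed
    with that \<open>0 < f u\<close> show ?thesis
      by (simp add: field_simps)
  qed
  then show ?thesis
    by (auto simp: bounded_iff)
qed

text \<open>
  A system of homogeneous inequalities reduces to a single one: the sum of the positive parts of
  all entries vanishes exactly when every entry is nonpositive.
\<close>

lemma bounded_homogeneous_le: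
  fixes h :: "'b :: euclidean_space \<Rightarrow> real ^ 'q ^ 'p"
  assumes cont: "continuous_on (sphere 0 1) h"
    and hom: "\<And>t x. 0 \<le> t \<Longrightarrow> h (t *\<^sub>R x) = t *\<^sub>R h x"
    and trivial: "\<And>x. h x \<le> 0 \<Longrightarrow> x = 0"
  shows "bounded {x. h x \<le> M}"
proof -
  define f where "f x = (\<Sum>i\<in>UNIV. \<Sum>j\<in>UNIV. max 0 (h x $ i $ j))" for x
  have "bounded {x. f x \<le> (\<Sum>i\<in>UNIV. \<Sum>j\<in>UNIV. max 0 (M $ i $ j))}"
  proof (rule bounded_homogeneous_sublevel)
    show "continuous_on (sphere 0 1) f"
      unfolding f_def by (intro continuous_intros cont)
  next
    fix t :: real and x :: 'b
    assume "0 \<le> t"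
    then show "f (t *\<^sub>R x) = t * f x"
      by (simp add: f_def hom sum_distrib_left max_mult_distrib_left)
  next
    fix x :: 'b
    assume "x \<noteq> 0"
    then obtain i j where "0 < h x $ i $ j"
      using trivial[of x] unfolding mat_le_iff zero_index by (meson not_le)
    then show "0 < f x"
      unfolding f_def by (intro sum_pos2[of _ i] sum_pos2[of _ j] sum_nonneg) auto
  qed
  then show ?thesis
    by (rule bounded_subset) (auto simp: f_def mat_le_iff intro!: sum_mono max.mono)
qed

section \<open>Boundedness of the united solution set\<close>

lemma bounded_united_solution_set:
  fixes \<A> \<C> :: "'a :: {real_normed_field, euclidean_space} ivl ^ 'm ^ 'm"
    and \<B> \<D> :: "'a ivl ^ 'n ^ 'n"
  assumes "\<forall>X :: 'a ^ 'n ^ 'm.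
      abs_mat (mid_mat \<A> ** X ** mid_mat \<B> + mid_mat \<C> ** X ** mid_mat \<D>)
        \<le> mag \<A> ** abs_mat X ** rad_mat \<B> + rad_mat \<A> ** abs_mat (X ** mid_mat \<B>)
          + mag \<C> ** abs_mat X ** rad_mat \<D> + rad_mat \<C> ** abs_mat (X ** mid_mat \<D>)
      \<longrightarrow> X = 0"
  shows "bounded (united_solution_set \<A> \<B> \<C> \<D> \<F>)"
proof (rule bounded_subset)
  show "bounded {X. residual \<A> \<B> \<C> \<D> X \<le> mag \<F>}"
  proof (rule bounded_homogeneous_le)
    fix X :: "'a ^ 'n ^ 'm"
    assume "residual \<A> \<B> \<C> \<D> X \<le> 0"
    then show "X = 0"
      using assms by (simp add: residual_def width_bound_def add.assoc)
  qed (simp_all add: continuous_on_residual residual_scaleR)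
  show "united_solution_set \<A> \<B> \<C> \<D> \<F> \<subseteq> {X. residual \<A> \<B> \<C> \<D> X \<le> mag \<F>}"
    using united_solution_residual_le by blast
qed

theorem theorem2p1:
  shows
    "(\<forall>(\<A> :: real ivl ^ 'm ^ 'm) (\<B> :: real ivl ^ 'n ^ 'n)
           (\<C> :: real ivl ^ 'm ^ 'm) (\<D> :: real ivl ^ 'n ^ 'n).
       (\<forall>X :: real ^ 'n ^ 'm.
          abs_mat (mid_mat \<A> ** X ** mid_mat \<B> + mid_mat \<C> ** X ** mid_mat \<D>)
            \<le> mag \<A> ** abs_mat X ** rad_mat \<B> + rad_mat \<A> ** abs_mat (X ** mid_mat \<B>)
              + mag \<C> ** abs_mat X ** rad_mat \<D> + rad_mat \<C> ** abs_mat (X ** mid_mat \<D>)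
          \<longrightarrow> X = 0)
       \<longrightarrow> (\<forall>\<F> :: real ivl ^ 'n ^ 'm. bounded (united_solution_set \<A> \<B> \<C> \<D> \<F>)))
     \<and>
     (\<forall>(\<A> :: complex ivl ^ 'm ^ 'm) (\<B> :: complex ivl ^ 'n ^ 'n)
           (\<C> :: complex ivl ^ 'm ^ 'm) (\<D> :: complex ivl ^ 'n ^ 'n).
       (\<forall>X :: complex ^ 'n ^ 'm.
          abs_mat (mid_mat \<A> ** X ** mid_mat \<B> + mid_mat \<C> ** X ** mid_mat \<D>)
            \<le> mag \<A> ** abs_mat X ** rad_mat \<B> + rad_mat \<A> ** abs_mat (X ** mid_mat \<B>)
              + mag \<C> ** abs_mat X ** rad_mat \<D> + rad_mat \<C> ** abs_mat (X ** mid_mat \<D>)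
          \<longrightarrow> X = 0)
       \<longrightarrow> (\<forall>\<F> :: complex ivl ^ 'n ^ 'm. bounded (united_solution_set \<A> \<B> \<C> \<D> \<F>)))"
  by (intro conjI allI impI; rule bounded_united_solution_set)

end
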